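(* Let $\mathcal{U}$ be a coinfinite subset of $\mathcal{V}$ and let $(S,T)$ be a $\mathcal{U}$-saturated $\mathbf{GL}$-pair. If $\Box\phi\in T$, then there exist a coinfinite subset $\mathcal{U}'$ of $\mathcal{V}$ and a $\mathcal{U}'$-saturated $\mathbf{GL}$-pair $(S',T')$ such that $\mathcal{U}\subseteq\mathcal{U}'$, $\phi\in T'$, and $\Box^{-1}S\cup\Box\Box^{-1}S\subseteq S'$.
   Context: Formulas are those of first-order modal logic over a countable set $\mathcal{V}$ of variables, with $\top,\bot$, predicate symbols of each finite arity (no function/constant symbols), $\land,\neg,\supset$, $\forall$, and $\Box$; $\Diamond=\neg\Box\neg$ and $\Diamond^n$ is $n$-fold $\Diamond$. For a set $S$ of formulas, $\Box S=\{\Box\psi\mid\psi\in S\}$ and $\Box^{-1}S=\{\psi\mid\Box\psi\in S\}$. $\mathsf{Var}(\phi)$ is the set of variables with a free or bound occurrence in $\phi$, and $\Phi(\mathcal{U})=\{\phi\mid\mathsf{Var}(\phi)\subseteq\mathcal{U}\}$. $\mathsf{NQGL}^-$ is the following sequent calculus (sequents $\Gamma\rightarrow\Delta$ are pairs of finite sets of formulas). Axioms: $p\rightarrow p$ ($p$ atomic), $\rightarrow\top$, $\bot\rightarrow$. Rules: weakening (from $\Gamma\rightarrow\Delta$ infer $\Gamma'\rightarrow\Delta'$ for $\Gamma\subseteq\Gamma'$, $\Delta\subseteq\Delta'$); standard LK rules for $\land$ (right: from $\Gamma\rightarrow\Delta,\phi$ and $\Gamma\rightarrow\Delta,\psi$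 infer $\Gamma\rightarrow\Delta,\phi\land\psi$; left: from $\phi,\Gamma\rightarrow\Delta$ or $\psi,\Gamma\rightarrow\Delta$ infer $\phi\land\psi,\Gamma\rightarrow\Delta$), for $\supset$ (right: from $\phi,\Gamma\rightarrow\Delta,\psi$ infer $\Gamma\rightarrow\Delta,\phi\supset\psi$; left: from $\Gamma\rightarrow\Delta,\phi$ and $\psi,\Lambda\rightarrow\Xi$ infer $\phi\supset\psi,\Gamma,\Lambda\rightarrow\Delta,\Xi$), for $\neg$ (from $\phi,\Gamma\rightarrow\Delta$ infer $\Gamma\rightarrow\Delta,\neg\phi$; from $\Gamma\rightarrow\Delta,\phi$ infer $\neg\phi,\Gamma\rightarrow\Delta$), for $\forall$ (from $\Gamma\rightarrow\Delta,\phi[y/x]$ infer $\Gamma\rightarrow\Delta,\forall x\phi$ with $y$ not occurring in the lower sequent; from $\phi[z/x],\Gamma\rightarrow\Delta$ infer $\forall x\phi,\Gamma\rightarrow\Delta$ for any $z$); (Box) from $\Box\Gamma,\Delta\rightarrow\phi$ infer $\Box\Gamma,\Box\Delta\rightarrow\Box\phi$; and (Boundedness of length) from $\Gamma\rightarrow\Delta,\Diamond^n\top$ for all $n\in\mathbb{N}$ infer $\Gamma\rightarrow\Delta$. There is no cut rule. $\vdash_{\mathsf{NQGL}^-}$ denotes derivability (derivations may be infinitary). A pair $(S,T)$ of sets of formulas is finitely consistent if $\not\vdash_{\mathsf{NQGL}^-}S'\rightarrow T'$ for all finite $S'\subseteq S$, $T'\subseteq T$. It is a $\mathbf{GL}$-pair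 if it is finitely consistent and $\Box\neg\Diamond^n\top\in S$ for some $n\in\mathbb{N}$. For $\mathcal{U}\subseteq\mathcal{V}$, a finitely consistent pair $(S,T)$ of subsets of $\Phi(\mathcal{U})$ is $\mathcal{U}$-saturated if: (1) $\phi_1\land\phi_2\in S$ implies $\phi_1,\phi_2\in S$, and $\phi_1\land\phi_2\in T$ implies $\phi_1\in T$ or $\phi_2\in T$; (2) $\phi_1\supset\phi_2\in S$ implies $\phi_1\in T$ or $\phi_2\in S$, and $\phi_1\supset\phi_2\in T$ implies $\phi_1\in S$ and $\phi_2\in T$; (3) $\neg\phi\in S$ implies $\phi\in T$, and $\neg\phi\in T$ implies $\phi\in S$; (4) $\forall x\phi\in S$ implies $\phi[z/x]\in S$ for all $z\in\mathcal{U}$, and $\forall x\phi\in T$ implies $\phi[z/x]\in T$ for some $z\in\mathcal{U}$.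
   Formalization: The set of predicate symbols is assumed countable, which the English states only for the variables; with uncountably many predicate symbols the claim fails, since uncountably many distinct witnesses could be forced. *)

theory Defs
  imports Main "HOL-Library.Countable" "HOL-Combinatorics.Transposition"
begin

text \<open>A predicate symbol is a name together with an arity, the latter being the length of the
  argument list.  The set function \<open>vars\<close> collects all free, bound and binding occurrences of
  variables; accordingly, the map function \<open>rename\<close> acts on binders as well.\<close>

datatype (dead 'p, vars: 'v) fm =
    Top
  | Bot
  | Pred 'p "'v list"
  | And "('p, 'v) fm" "('p, 'v) fm"
  | Neg "('p, 'v) fm"
  | Imp "('p, 'v) fm" "('p, 'v) fm"
  | Forall 'v "('p, 'v) fm"
  | Box "('p, 'v) fm"
  for map: rename

definition Dia :: "('p, 'v) fm \<Rightarrow> ('p, 'v) fm" where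
  "Dia \<phi> = Neg (Box (Neg \<phi>))"

primrec fv :: "('p, 'v) fm \<Rightarrow> 'v set" where
  "fv Top = {}"
| "fv Bot = {}"
| "fv (Pred p xs) = set xs"
| "fv (And \<phi> \<psi>) = fv \<phi> \<union> fv \<psi>"
| "fv (Neg \<phi>) = fv \<phi>"
| "fv (Imp \<phi> \<psi>) = fv \<phi> \<union> fv \<psi>"
| "fv (Forall x \<phi>) = fv \<phi> - {x}"
| "fv (Box \<phi>) = fv \<phi>"

text \<open>\<open>subst z x \<phi>\<close> is the capture-avoiding substitution \<open>\<phi>[z/x]\<close>.  If a free occurrence of \<open>x\<close>
  is in the scope of a quantifier over \<open>z\<close>, that quantifier has to be renamed.  Its new name is
  \<open>x\<close> itself: \<open>z\<close> is not free in \<open>\<forall>z \<phi>\<close>, so exchanging \<open>x\<close> and \<open>z\<close> throughout has the effect of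
  the substitution up to renaming of bound variables.  This choice introduces no variable other
  than \<open>z\<close>, so that formulas over a set \<open>U\<close> of variables are closed under substitution of
  elements of \<open>U\<close>, even when \<open>U\<close> is finite.\<close>

primrec subst :: "'v \<Rightarrow> 'v \<Rightarrow> ('p, 'v) fm \<Rightarrow> ('p, 'v) fm" where
  "subst z x Top = Top"
| "subst z x Bot = Bot"
| "subst z x (Pred p xs) = Pred p (map (id(x := z)) xs)"
| "subst z x (And \<phi> \<psi>) = And (subst z x \<phi>) (subst z x \<psi>)"
| "subst z x (Neg \<phi>) = Neg (subst z x \<phi>)"
| "subst z x (Imp \<phi> \<psi>) = Imp (subst z x \<phi>) (subst z x \<psi>)"
| "subst z x (Forall y \<phi>) =
     (if x \<notin> fv (Forall y \<phi>) then Forall y \<phi>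
      else if y = z then Forall x (rename (transpose x z) \<phi>)
      else Forall y (subst z x \<phi>))"
| "subst z x (Box \<phi>) = Box (subst z x \<phi>)"

lemma fv_subset_vars: "fv \<phi> \<subseteq> vars \<phi>"
  by (induction \<phi>) auto

lemma fv_rename: "inj f \<Longrightarrow> fv (rename f \<phi>) = f ` fv \<phi>"
  by (induction \<phi>) (auto simp: inj_def)

lemma fv_subst: "fv (subst z x \<phi>) = id(x := z) ` fv \<phi>"
proof (induction \<phi>)
  case (Forall y \<phi>)
  show ?case
  proof (cases "x \<in> fv (Forall y \<phi>) \<and> y = z")
    case True
    then show ?thesis
      by (auto simp: fv_rename transpose_def image_iff split: if_splits)
  qed (use Forall in \<open>auto simp: image_iff\<close>)
qed auto

lemma vars_subst: "vars (subst z x \<phi>) \<subseteq> insert z (vars \<phi>)"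
proof (induction \<phi>)
  case (Forall y \<phi>)
  then show ?case
    using fv_subset_vars[of \<phi>] by (auto simp: fm.set_map transpose_def split: if_splits)
qed auto

text \<open>Sequents are pairs of finite sets: finiteness is imposed in the weakening rule and
  preserved by all others.\<close>

inductive derivable :: "('p, 'v) fm set \<Rightarrow> ('p, 'v) fm set \<Rightarrow> bool" (infix \<open>\<turnstile>\<close> 50) where
  ax_atom: "{Pred p xs} \<turnstile> {Pred p xs}"
| ax_top: "{} \<turnstile> {Top}"
| ax_bot: "{Bot} \<turnstile> {}"
| weakening: "\<lbrakk>\<Gamma> \<turnstile> \<Delta>; \<Gamma> \<subseteq> \<Gamma>'; \<Delta> \<subseteq> \<Delta>'; finite \<Gamma>'; finite \<Delta>'\<rbrakk> \<Longrightarrow> \<Gamma>' \<turnstile> \<Delta>'"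
| and_right: "\<lbrakk>\<Gamma> \<turnstile> insert \<phi> \<Delta>; \<Gamma> \<turnstile> insert \<psi> \<Delta>\<rbrakk> \<Longrightarrow> \<Gamma> \<turnstile> insert (And \<phi> \<psi>) \<Delta>"
| and_left1: "insert \<phi> \<Gamma> \<turnstile> \<Delta> \<Longrightarrow> insert (And \<phi> \<psi>) \<Gamma> \<turnstile> \<Delta>"
| and_left2: "insert \<psi> \<Gamma> \<turnstile> \<Delta> \<Longrightarrow> insert (And \<phi> \<psi>) \<Gamma> \<turnstile> \<Delta>"
| imp_right: "insert \<phi> \<Gamma> \<turnstile> insert \<psi> \<Delta> \<Longrightarrow> \<Gamma> \<turnstile> insert (Imp \<phi> \<psi>) \<Delta>"
| imp_left: "\<lbrakk>\<Gamma> \<turnstile> insert \<phi> \<Delta>; insert \<psi> \<Lambda> \<turnstile> \<Xi>\<rbrakk> \<Longrightarrow> insert (Imp \<phi> \<psi>) (\<Gamma> \<union> \<Lambda>) \<turnstile> \<Delta> \<union> \<Xi>"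
| neg_right: "insert \<phi> \<Gamma> \<turnstile> \<Delta> \<Longrightarrow> \<Gamma> \<turnstile> insert (Neg \<phi>) \<Delta>"
| neg_left: "\<Gamma> \<turnstile> insert \<phi> \<Delta> \<Longrightarrow> insert (Neg \<phi>) \<Gamma> \<turnstile> \<Delta>"
| forall_right: "\<lbrakk>\<Gamma> \<turnstile> insert (subst y x \<phi>) \<Delta>; y \<notin> \<Union> (vars ` (\<Gamma> \<union> insert (Forall x \<phi>) \<Delta>))\<rbrakk>
    \<Longrightarrow> \<Gamma> \<turnstile> insert (Forall x \<phi>) \<Delta>"
| forall_left: "insert (subst z x \<phi>) \<Gamma> \<turnstile> \<Delta> \<Longrightarrow> insert (Forall x \<phi>) \<Gamma> \<turnstile> \<Delta>"
| box: "Box ` \<Gamma> \<union> \<Delta> \<turnstile> {\<phi>} \<Longrightarrow> Box ` \<Gamma> \<union> Box ` \<Delta> \<turnstile> {Box \<phi>}"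
| bounded_length: "(\<And>n. \<Gamma> \<turnstile> insert ((Dia ^^ n) Top) \<Delta>) \<Longrightarrow> \<Gamma> \<turnstile> \<Delta>"

lemma derivable_finite: "\<Gamma> \<turnstile> \<Delta> \<Longrightarrow> finite \<Gamma> \<and> finite \<Delta>"
  by (induction rule: derivable.induct) auto

definition finitely_consistent :: "('p, 'v) fm set \<Rightarrow> ('p, 'v) fm set \<Rightarrow> bool" where
  "finitely_consistent S T \<longleftrightarrow>
     (\<forall>S' T'. finite S' \<and> S' \<subseteq> S \<and> finite T' \<and> T' \<subseteq> T \<longrightarrow> \<not> S' \<turnstile> T')"

definition GL_pair :: "('p, 'v) fm set \<Rightarrow> ('p, 'v) fm set \<Rightarrow> bool" where
  "GL_pair S T \<longleftrightarrow> finitely_consistent S T \<and> (\<exists>n. Box (Neg ((Dia ^^ n) Top)) \<in> S)"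

definition formulas_over :: "'v set \<Rightarrow> ('p, 'v) fm set" where
  "formulas_over U = {\<phi>. vars \<phi> \<subseteq> U}"

definition saturated :: "'v set \<Rightarrow> ('p, 'v) fm set \<Rightarrow> ('p, 'v) fm set \<Rightarrow> bool" where
  "saturated U S T \<longleftrightarrow>
     finitely_consistent S T \<and> S \<subseteq> formulas_over U \<and> T \<subseteq> formulas_over U \<and>
     (\<forall>\<phi> \<psi>. And \<phi> \<psi> \<in> S \<longrightarrow> \<phi> \<in> S \<and> \<psi> \<in> S) \<and>
     (\<forall>\<phi> \<psi>. And \<phi> \<psi> \<in> T \<longrightarrow> \<phi> \<in> T \<or> \<psi> \<in> T) \<and>
     (\<forall>\<phi> \<psi>. Imp \<phi> \<psi> \<in> S \<longrightarrow> \<phi> \<in> T \<or> \<psi> \<in> S) \<and>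
     (\<forall>\<phi> \<psi>. Imp \<phi> \<psi> \<in> T \<longrightarrow> \<phi> \<in> S \<and> \<psi> \<in> T) \<and>
     (\<forall>\<phi>. Neg \<phi> \<in> S \<longrightarrow> \<phi> \<in> T) \<and>
     (\<forall>\<phi>. Neg \<phi> \<in> T \<longrightarrow> \<phi> \<in> S) \<and>
     (\<forall>x \<phi>. Forall x \<phi> \<in> S \<longrightarrow> (\<forall>z\<in>U. subst z x \<phi> \<in> S)) \<and>
     (\<forall>x \<phi>. Forall x \<phi> \<in> T \<longrightarrow> (\<exists>z\<in>U. subst z x \<phi> \<in> T))"

abbreviation coinfinite :: "'v set \<Rightarrow> bool" where
  "coinfinite U \<equiv> infinite (- U)"

end

theory Submission
  imports Defs
begin

text \<open>The box rule shows that \<open>(\<box>\<^sup>-\<^sup>1S \<union> \<box>\<box>\<^sup>-\<^sup>1S, {\<phi>})\<close> is finitely consistent.  It is then extended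
  to a maximal finitely consistent pair by a Henkin construction with witnesses drawn from an
  infinite, coinfinite part of the unused variables.  Maximality yields the saturation
  conditions from the left and right rules alone, so that the absence of cut does no harm.\<close>

section \<open>Countability of the set of formulas\<close>

primrec encode_fm :: "('p :: countable, 'v :: countable) fm \<Rightarrow> nat" where
  "encode_fm Top = prod_encode (0, 0)"
| "encode_fm Bot = prod_encode (1, 0)"
| "encode_fm (Pred p xs) = prod_encode (2, to_nat (p, xs))"
| "encode_fm (And \<phi> \<psi>) = prod_encode (3, prod_encode (encode_fm \<phi>, encode_fm \<psi>))"
| "encode_fm (Neg \<phi>) = prod_encode (4, encode_fm \<phi>)"
| "encode_fm (Imp \<phi> \<psi>) = prod_encode (5, prod_encode (encode_fm \<phi>, encode_fm \<psi>))"
| "encode_fm (Forall x \<phi>) = prod_encode (6, prod_encode (to_nat x, encode_fm \<phi>))"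
| "encode_fm (Box \<phi>) = prod_encode (7, encode_fm \<phi>)"

lemma encode_fm_inject: "encode_fm \<phi> = encode_fm \<psi> \<Longrightarrow> \<phi> = \<psi>"
proof (induction \<phi> arbitrary: \<psi>)
qed (case_tac \<psi>; simp; fail)+

text \<open>Provides the enumeration \<open>from_nat\<close> of all formulas that drives the Henkin
  construction.\<close>

instance fm :: (countable, countable) countable
  by (rule countable_classI[of encode_fm]) (rule encode_fm_inject)

section \<open>Finite consistency and its failure\<close>

lemma finitely_consistentD:
  assumes "finitely_consistent S T" "\<Gamma> \<turnstile> \<Delta>" "\<Gamma> \<subseteq> S" "\<Delta> \<subseteq> T"
  shows False
  using assms(1)[unfolded finitely_consistent_def, rule_format, of \<Gamma> \<Delta>]
    derivable_finite[OF assms(2)] assms(2-4) by blast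

lemma finitely_consistentI:
  "(\<And>\<Gamma> \<Delta>. \<lbrakk>\<Gamma> \<turnstile> \<Delta>; \<Gamma> \<subseteq> S; \<Delta> \<subseteq> T\<rbrakk> \<Longrightarrow> False) \<Longrightarrow> finitely_consistent S T"
  unfolding finitely_consistent_def by blast

lemma finitely_consistent_mono:
  "\<lbrakk>finitely_consistent S T; S' \<subseteq> S; T' \<subseteq> T\<rbrakk> \<Longrightarrow> finitely_consistent S' T'"
  unfolding finitely_consistent_def by (meson order_trans)

text \<open>Weakening forces all of \<open>A\<close> and \<open>B\<close> into the refuting sequent,
  even if the given derivation does not mention them. The sequent thus has the exact shape of a
  premise of the logical rules, with a context drawn from \<open>S\<close> and
  \<open>T\<close>.\<close>

lemma inconsistent_insertE:
  assumes "\<not> finitely_consistent (A \<union> S) (B \<union> T)" "finite A" "finite B"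
  obtains \<Gamma> \<Delta> where "finite \<Gamma>" "finite \<Delta>" "\<Gamma> \<subseteq> S" "\<Delta> \<subseteq> T" "A \<union> \<Gamma> \<turnstile> B \<union> \<Delta>"
proof -
  obtain \<Gamma> \<Delta> where *: "\<Gamma> \<turnstile> \<Delta>" "\<Gamma> \<subseteq> A \<union> S" "\<Delta> \<subseteq> B \<union> T"
    using assms(1) unfolding finitely_consistent_def by blast
  have fin: "finite \<Gamma>" "finite \<Delta>"
    using derivable_finite[OF *(1)] by auto
  have "A \<union> (\<Gamma> - A) \<turnstile> B \<union> (\<Delta> - B)"
    by (rule weakening[OF *(1)]) (use fin assms in auto)
  then show thesis
    using that[of "\<Gamma> - A" "\<Delta> - B"] fin * by blast
qed

lemma inconsistent_leftE:
  assumes "\<not> finitely_consistent (insert \<phi> S) T"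
  obtains \<Gamma> \<Delta> where "finite \<Gamma>" "finite \<Delta>" "\<Gamma> \<subseteq> S" "\<Delta> \<subseteq> T" "insert \<phi> \<Gamma> \<turnstile> \<Delta>"
  using inconsistent_insertE[of "{\<phi>}" S "{}" T] assms by auto

lemma inconsistent_rightE:
  assumes "\<not> finitely_consistent S (insert \<phi> T)"
  obtains \<Gamma> \<Delta> where "finite \<Gamma>" "finite \<Delta>" "\<Gamma> \<subseteq> S" "\<Delta> \<subseteq> T" "\<Gamma> \<turnstile> insert \<phi> \<Delta>"
  using inconsistent_insertE[of "{}" S "{\<phi>}" T] assms by auto

section \<open>Rules of the calculus read as preservation of consistency\<close>

context
  fixes S T :: "('p, 'v) fm set"
  assumes cons: "finitely_consistent S T"
begin

text \<open>Pattern of the lemmas for the connectives and the quantifier: if every way of adding the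
  components were inconsistent, the matching rule would derive a sequent inside
  \<open>(S, T)\<close>, because the compound formula already belongs to it.\<close>

lemma consistent_and_left:
  assumes "And \<phi> \<psi> \<in> S"
  shows "finitely_consistent (insert \<phi> S) T" "finitely_consistent (insert \<psi> S) T"
proof -
  show "finitely_consistent (insert \<phi> S) T"
    by (rule ccontr, erule inconsistent_leftE, drule and_left1[where \<psi> = \<psi>],
        erule finitely_consistentD[OF cons]) (use assms in auto)
  show "finitely_consistent (insert \<psi> S) T"
    by (rule ccontr, erule inconsistent_leftE, drule and_left2[where \<phi> = \<phi>],
        erule finitely_consistentD[OF cons]) (use assms in auto)
qed

lemma consistent_and_right:
  assumes "And \<phi> \<psi> \<in> T"
  shows "finitely_consistent S (insert \<phi> T) \<or> finitely_consistent S (insert \<psi> T)"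
proof (rule ccontr)
  assume "\<not> ?thesis"
  then obtain \<Gamma> \<Delta> \<Gamma>' \<Delta>' where *:
    "finite \<Gamma>" "finite \<Delta>" "\<Gamma> \<subseteq> S" "\<Delta> \<subseteq> T" "\<Gamma> \<turnstile> insert \<phi> \<Delta>"
    "finite \<Gamma>'" "finite \<Delta>'" "\<Gamma>' \<subseteq> S" "\<Delta>' \<subseteq> T" "\<Gamma>' \<turnstile> insert \<psi> \<Delta>'"
    by (metis inconsistent_rightE)
  \<comment> \<open>The two premises of \<open>and_right\<close> share their context, so both are
    first weakened to the union. For \<open>imp_left\<close>, with separate contexts, this is
    unnecessary.\<close>
  have "\<Gamma> \<union> \<Gamma>' \<turnstile> insert \<phi> (\<Delta> \<union> \<Delta>')" "\<Gamma> \<union> \<Gamma>' \<turnstile> insert \<psi> (\<Delta> \<union> \<Delta>')"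
    using * by (auto intro: weakening[OF *(5)] weakening[OF *(10)])
  then have "\<Gamma> \<union> \<Gamma>' \<turnstile> insert (And \<phi> \<psi>) (\<Delta> \<union> \<Delta>')"
    by (rule and_right)
  then show False
    by (rule finitely_consistentD[OF cons]) (use * assms in auto)
qed

lemma consistent_imp_left:
  assumes "Imp \<phi> \<psi> \<in> S"
  shows "finitely_consistent S (insert \<phi> T) \<or> finitely_consistent (insert \<psi> S) T"
proof (rule ccontr)
  assume "\<not> ?thesis"
  then obtain \<Gamma> \<Delta> \<Lambda> \<Xi> where *:
    "\<Gamma> \<subseteq> S" "\<Delta> \<subseteq> T" "\<Gamma> \<turnstile> insert \<phi> \<Delta>"
    "\<Lambda> \<subseteq> S" "\<Xi> \<subseteq> T" "insert \<psi> \<Lambda> \<turnstile> \<Xi>"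
    by (metis inconsistent_leftE inconsistent_rightE)
  show False
    by (rule finitely_consistentD[OF cons imp_left[OF *(3,6)]]) (use * assms in auto)
qed

lemma consistent_imp_right:
  assumes "Imp \<phi> \<psi> \<in> T"
  shows "finitely_consistent (insert \<phi> S) (insert \<psi> T)"
proof (rule ccontr)
  assume "\<not> ?thesis"
  then have "\<not> finitely_consistent ({\<phi>} \<union> S) ({\<psi>} \<union> T)"
    by simp
  then obtain \<Gamma> \<Delta> where *: "\<Gamma> \<subseteq> S" "\<Delta> \<subseteq> T" "insert \<phi> \<Gamma> \<turnstile> insert \<psi> \<Delta>"
    by (rule inconsistent_insertE) auto
  show False
    by (rule finitely_consistentD[OF cons imp_right[OF *(3)]]) (use * assms in auto)
qed

lemma consistent_neg_left:
  assumes "Neg \<phi> \<in> S"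
  shows "finitely_consistent S (insert \<phi> T)"
  by (rule ccontr, erule inconsistent_rightE, drule neg_left,
      erule finitely_consistentD[OF cons]) (use assms in auto)

lemma consistent_neg_right:
  assumes "Neg \<phi> \<in> T"
  shows "finitely_consistent (insert \<phi> S) T"
  by (rule ccontr, erule inconsistent_leftE, drule neg_right,
      erule finitely_consistentD[OF cons]) (use assms in auto)

lemma consistent_forall_left:
  assumes "Forall x \<phi> \<in> S"
  shows "finitely_consistent (insert (subst z x \<phi>) S) T"
  by (rule ccontr, erule inconsistent_leftE, drule forall_left,
      erule finitely_consistentD[OF cons]) (use assms in auto)

text \<open>A variable that is fresh for the whole pair is fresh for each finite part of it, and the
  quantified formula lies in \<open>T\<close>, so the eigenvariable condition holds.\<close>

lemma consistent_forall_right: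
  assumes "Forall x \<phi> \<in> T" and fresh: "y \<notin> \<Union> (vars ` (S \<union> T))"
  shows "finitely_consistent S (insert (subst y x \<phi>) T)"
proof (rule ccontr)
  assume "\<not> ?thesis"
  then obtain \<Gamma> \<Delta> where *: "\<Gamma> \<subseteq> S" "\<Delta> \<subseteq> T" "\<Gamma> \<turnstile> insert (subst y x \<phi>) \<Delta>"
    by (metis inconsistent_rightE)
  have "\<Gamma> \<turnstile> insert (Forall x \<phi>) \<Delta>"
    by (rule forall_right[OF *(3)]) (use * assms in blast)
  then show False
    by (rule finitely_consistentD[OF cons]) (use * assms in auto)
qed

text \<open>The box rule admits in its premise both boxed and unboxed copies of the formulas whose
  boxes stand on the left of its conclusion. A refutation therefore yields a sequent with left side
  in \<open>S\<close> and right side \<open>Box \<phi>\<close>.\<close>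

lemma consistent_box:
  assumes "Box \<phi> \<in> T"
  shows "finitely_consistent (Box -` S \<union> Box ` (Box -` S)) {\<phi>}"
proof (rule finitely_consistentI)
  fix \<Gamma> \<Delta>
  assume *: "\<Gamma> \<turnstile> \<Delta>" "\<Gamma> \<subseteq> Box -` S \<union> Box ` (Box -` S)" "\<Delta> \<subseteq> {\<phi>}"
  have fin: "finite \<Gamma>"
    using derivable_finite[OF *(1)] by blast
  \<comment> \<open>Bodies of the members of the sequent that occur boxed are put in
    \<open>\<Lambda>\<close>, members occurring as they stand in \<open>\<Xi>\<close>. The two may
    overlap in effect, since a member can itself be a box.\<close>
  define \<Lambda> where "\<Lambda> = Box -` \<Gamma> \<inter> Box -` S"
  define \<Xi> where "\<Xi> = \<Gamma> \<inter> Box -` S"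
  have "finite \<Lambda>" "finite \<Xi>"
    using fin by (auto simp: \<Lambda>_def \<Xi>_def intro!: finite_vimageI injI)
  moreover have "\<Gamma> \<subseteq> Box ` \<Lambda> \<union> \<Xi>"
    using *(2) by (auto simp: \<Lambda>_def \<Xi>_def)
  ultimately have "Box ` \<Lambda> \<union> \<Xi> \<turnstile> {\<phi>}"
    using weakening[OF *(1)] *(3) by simp
  then have "Box ` \<Lambda> \<union> Box ` \<Xi> \<turnstile> {Box \<phi>}"
    by (rule box)
  then show False
    by (rule finitely_consistentD[OF cons]) (use assms in \<open>auto simp: \<Lambda>_def \<Xi>_def\<close>)
qed

end

section \<open>Saturation from maximality\<close>

lemma subst_in_formulas_over:
  "\<lbrakk>Forall x \<phi> \<in> formulas_over V; z \<in> V\<rbrakk> \<Longrightarrow> subst z x \<phi> \<in> formulas_over V"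
  using vars_subst[of z x \<phi>] by (auto simp: formulas_over_def)

text \<open>Components can be added consistently by the lemmas above, so maximality says that they
  are present. A universal formula on the right is the exception: its rule asks for a fresh
  variable, and a maximal pair may have used all of \<open>V\<close>. Hence the separate assumption
  \<open>wit\<close>.\<close>

lemma maximal_imp_saturated:
  assumes cons: "finitely_consistent S T"
    and S: "S \<subseteq> formulas_over V" and T: "T \<subseteq> formulas_over V"
    and maxS: "\<And>\<chi>. \<lbrakk>\<chi> \<in> formulas_over V; finitely_consistent (insert \<chi> S) T\<rbrakk> \<Longrightarrow> \<chi> \<in> S"
    and maxT: "\<And>\<chi>. \<lbrakk>\<chi> \<in> formulas_over V; finitely_consistent S (insert \<chi> T)\<rbrakk> \<Longrightarrow> \<chi> \<in> T"
    and wit: "\<And>x \<psi>. Forall x \<psi> \<in> T \<Longrightarrow> \<exists>z\<in>V. subst z x \<psi> \<in> T"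
  shows "saturated V S T"
proof (unfold saturated_def, intro conjI allI impI ballI)
  show "\<phi> \<in> S" "\<psi> \<in> S" if *: "And \<phi> \<psi> \<in> S" for \<phi> \<psi>
    using maxS consistent_and_left[OF cons *] S * by (auto simp: formulas_over_def)
  show "\<phi> \<in> T \<or> \<psi> \<in> T" if *: "And \<phi> \<psi> \<in> T" for \<phi> \<psi>
    using maxT consistent_and_right[OF cons *] T * by (auto simp: formulas_over_def)
  show "\<phi> \<in> T \<or> \<psi> \<in> S" if *: "Imp \<phi> \<psi> \<in> S" for \<phi> \<psi>
    using maxS maxT consistent_imp_left[OF cons *] S * by (auto simp: formulas_over_def)
  show "\<phi> \<in> S" "\<psi> \<in> T" if *: "Imp \<phi> \<psi> \<in> T" for \<phi> \<psi>
  proof -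
    have "finitely_consistent (insert \<phi> S) T" "finitely_consistent S (insert \<psi> T)"
      by (auto intro: finitely_consistent_mono[OF consistent_imp_right[OF cons *]])
    then show "\<phi> \<in> S" "\<psi> \<in> T"
      using maxS maxT T * by (auto simp: formulas_over_def)
  qed
  show "\<phi> \<in> T" if *: "Neg \<phi> \<in> S" for \<phi>
    using maxT consistent_neg_left[OF cons *] S * by (auto simp: formulas_over_def)
  show "\<phi> \<in> S" if *: "Neg \<phi> \<in> T" for \<phi>
    using maxS consistent_neg_right[OF cons *] T * by (auto simp: formulas_over_def)
  show "subst z x \<phi> \<in> S" if *: "Forall x \<phi> \<in> S" "z \<in> V" for x \<phi> z
    by (rule maxS[OF subst_in_formulas_over consistent_forall_left[OF cons *(1)]])
      (use S * in auto)
qed (fact cons S T wit)+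

section \<open>Stages of the Henkin construction\<close>

text \<open>A stage uses only finitely many elements of \<open>W\<close>, so that a fresh witness remains.\<close>

definition stage :: "'v set \<Rightarrow> 'v set \<Rightarrow> ('p, 'v) fm set \<times> ('p, 'v) fm set \<Rightarrow> bool" where
  "stage U W P \<longleftrightarrow> finitely_consistent (fst P) (snd P) \<and>
     (\<exists>F. finite F \<and> F \<subseteq> W \<and> fst P \<union> snd P \<subseteq> formulas_over (U \<union> F))"

text \<open>The consistency test refers to the new stage \<open>Q\<close>; hence \<open>Forall x \<psi>\<close> receives a witness
  also when it had already been added before.\<close>

definition decides :: "'v set \<Rightarrow> ('p, 'v) fm \<Rightarrow> ('p, 'v) fm set \<times> ('p, 'v) fm set \<Rightarrow> bool" where
  "decides V \<chi> Q \<longleftrightarrow>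
     (finitely_consistent (insert \<chi> (fst Q)) (snd Q) \<longrightarrow> \<chi> \<in> fst Q) \<and>
     (finitely_consistent (fst Q) (insert \<chi> (snd Q)) \<longrightarrow>
        \<chi> \<in> snd Q \<and> (\<forall>x \<psi>. \<chi> = Forall x \<psi> \<longrightarrow> (\<exists>z\<in>V. subst z x \<psi> \<in> snd Q)))"

text \<open>A formula has finitely many variables, so \<open>F\<close> stays finite when those lying
  in \<open>W\<close> are added to it.\<close>

lemma stage_insert:
  assumes "stage U W (S, T)" "\<chi> \<in> formulas_over (U \<union> W)"
  shows "finitely_consistent (insert \<chi> S) T \<Longrightarrow> stage U W (insert \<chi> S, T)"
    and "finitely_consistent S (insert \<chi> T) \<Longrightarrow> stage U W (S, insert \<chi> T)"
proof -
  obtain F where F: "finite F" "F \<subseteq> W" "S \<union> T \<subseteq> formulas_over (U \<union> F)"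
    using assms(1) by (auto simp: stage_def)
  define F' where "F' = F \<union> (vars \<chi> \<inter> W)"
  have "finite (vars \<chi>)"
    by (induction \<chi>) auto
  then have "finite F'" "F' \<subseteq> W" "insert \<chi> (S \<union> T) \<subseteq> formulas_over (U \<union> F')"
    using F assms(2) by (auto simp: F'_def formulas_over_def)
  then show "finitely_consistent (insert \<chi> S) T \<Longrightarrow> stage U W (insert \<chi> S, T)"
    and "finitely_consistent S (insert \<chi> T) \<Longrightarrow> stage U W (S, insert \<chi> T)"
    by (auto simp: stage_def)
qed

lemma stage_extend:
  assumes P: "stage U W P" and W: "infinite W" "U \<inter> W = {}" and \<chi>: "\<chi> \<in> formulas_over (U \<union> W)"
  obtains Q where "stage U W Q" "fst P \<subseteq> fst Q" "snd P \<subseteq> snd Q" "decides (U \<union> W) \<chi> Q"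
proof -
  obtain S T where P_eq: "P = (S, T)"
    by (cases P)
  \<comment> \<open>The left side is tried first; the right side is then tested against the
    result.\<close>
  define S1 where "S1 = (if finitely_consistent (insert \<chi> S) T then insert \<chi> S else S)"
  have S1: "stage U W (S1, T)" "S \<subseteq> S1"
    using P stage_insert(1)[OF _ \<chi>] by (auto simp: S1_def P_eq)
  \<comment> \<open>Consistency passes to smaller pairs, so the decision on the left stays correct
    whatever is later added on the right, including the witness.\<close>
  have left: "\<chi> \<in> S1" if "finitely_consistent (insert \<chi> S1) T1" "T \<subseteq> T1" for T1
  proof -
    have "finitely_consistent (insert \<chi> S) T"
      using finitely_consistent_mono[OF that(1)] S1(2) that(2) by (meson insert_mono)
    then show ?thesis
      by (simp add: S1_def)
  qed
  show thesis
  proof (cases "finitely_consistent S1 (insert \<chi> T)")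
    case False
    then show thesis
      using that[of "(S1, T)"] S1 left[of T] by (simp add: decides_def P_eq)
  next
    case True
    then have T1: "stage U W (S1, insert \<chi> T)"
      using stage_insert(2)[OF S1(1) \<chi>] by blast
    show thesis
    proof (cases "\<exists>x \<psi>. \<chi> = Forall x \<psi>")
      case False
      then show thesis
        using that[of "(S1, insert \<chi> T)"] S1 T1 left[of "insert \<chi> T"]
        by (auto simp: decides_def P_eq)
    next
      case True
      then obtain x \<psi> where \<chi>_eq: "\<chi> = Forall x \<psi>"
        by blast
      obtain F where F: "finite F" "F \<subseteq> W" "S1 \<union> insert \<chi> T \<subseteq> formulas_over (U \<union> F)"
        using T1 by (auto simp: stage_def)
      obtain y where y: "y \<in> W" "y \<notin> F"
        using F(1,2) W(1) by (metis finite_subset subsetI)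
      \<comment> \<open>All variables in use lie in \<open>U\<close> or \<open>F\<close>;
        \<open>y\<close> avoids \<open>F\<close> by choice and \<open>U\<close> by
        disjointness.\<close>
      have fresh: "y \<notin> \<Union> (vars ` (S1 \<union> insert \<chi> T))"
        using F(3) y W(2) unfolding formulas_over_def by blast
      have "finitely_consistent S1 (insert \<chi> T)"
        using T1 by (simp add: stage_def)
      then have "finitely_consistent S1 (insert (subst y x \<psi>) (insert \<chi> T))"
        using fresh by (intro consistent_forall_right) (auto simp: \<chi>_eq)
      then have "stage U W (S1, insert (subst y x \<psi>) (insert \<chi> T))"
        using \<chi> y(1) by (intro stage_insert(2)[OF T1] subst_in_formulas_over) (auto simp: \<chi>_eq)
      then show thesis
        using that[of "(S1, insert (subst y x \<psi>) (insert \<chi> T))"] S1(2) y(1)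
          left[of "insert (subst y x \<psi>) (insert \<chi> T)"]
        by (auto simp: decides_def P_eq \<chi>_eq)
    qed
  qed
qed

section \<open>The limit of the stages\<close>

text \<open>Derivations may be infinite, but the derived sequent is finite, so each of its sides
  already lies in one member of the chain.\<close>

lemma finitely_consistent_UN_chain:
  fixes A B :: "nat \<Rightarrow> ('p, 'v) fm set"
  assumes "mono A" "mono B" and cons: "\<And>n. finitely_consistent (A n) (B n)"
  shows "finitely_consistent (\<Union>n. A n) (\<Union>n. B n)"
proof (rule finitely_consistentI)
  have chain: "\<exists>n. X \<subseteq> C n" if "finite X" "X \<subseteq> (\<Union>n. C n)" "mono C"
    for X and C :: "nat \<Rightarrow> ('p, 'v) fm set"
    using that(1,2)
  proof (induction X rule: finite_induct)
    case (insert a X)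
    then obtain m n where "X \<subseteq> C m" "a \<in> C n"
      by blast
    then have "insert a X \<subseteq> C (max m n)"
      using monoD[OF \<open>mono C\<close>, of m "max m n"] monoD[OF \<open>mono C\<close>, of n "max m n"] by auto
    then show ?case ..
  qed simp
  fix \<Gamma> \<Delta>
  assume *: "\<Gamma> \<turnstile> \<Delta>" "\<Gamma> \<subseteq> (\<Union>n. A n)" "\<Delta> \<subseteq> (\<Union>n. B n)"
  obtain m n where "\<Gamma> \<subseteq> A m" "\<Delta> \<subseteq> B n"
    using chain[of \<Gamma> A] chain[of \<Delta> B] * derivable_finite[OF *(1)] assms(1,2) by blast
  then have "\<Gamma> \<subseteq> A (max m n)" "\<Delta> \<subseteq> B (max m n)"
    using monoD[OF assms(1), of m "max m n"] monoD[OF assms(2), of n "max m n"] by auto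
  then show False
    using finitely_consistentD[OF cons *(1)] by blast
qed

lemma saturated_extension:
  fixes U W :: "'v :: countable set" and S T :: "('p :: countable, 'v) fm set"
  assumes cons: "finitely_consistent S T"
    and over: "S \<subseteq> formulas_over U" "T \<subseteq> formulas_over U"
    and W: "infinite W" "U \<inter> W = {}"
  obtains S' T' where "saturated (U \<union> W) S' T'" "S \<subseteq> S'" "T \<subseteq> T'"
proof -
  let ?V = "U \<union> W"
  let ?e = "from_nat :: nat \<Rightarrow> ('p, 'v) fm"
  have "stage U W (S, T)"
    using cons over by (auto simp: stage_def intro!: exI[of _ "{}"])
  moreover have "\<exists>Q. stage U W Q \<and> (fst P \<subseteq> fst Q \<and> snd P \<subseteq> snd Q \<and>
      (?e n \<in> formulas_over ?V \<longrightarrow> decides ?V (?e n) Q))"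
    if "stage U W P" for P :: "('p, 'v) fm set \<times> ('p, 'v) fm set" and n
  proof (cases "?e n \<in> formulas_over ?V")
    case True
    then show ?thesis
      using stage_extend[OF that W True] by metis
  \<comment> \<open>A formula with variables outside \<open>?V\<close> is skipped: the stage
    \<open>P\<close> is repeated.\<close>
  qed (use that in blast)
  ultimately obtain f :: "nat \<Rightarrow> ('p, 'v) fm set \<times> ('p, 'v) fm set" where
    f0: "f 0 = (S, T)" and stage: "\<And>n. stage U W (f n)"
    and f_Suc: "\<And>n. fst (f n) \<subseteq> fst (f (Suc n))" "\<And>n. snd (f n) \<subseteq> snd (f (Suc n))"
      "\<And>n. ?e n \<in> formulas_over ?V \<Longrightarrow> decides ?V (?e n) (f (Suc n))"
    \<comment> \<open>The conjunct for \<open>n = 0\<close> pins the chain to the given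
      pair.\<close>
    using dependent_nat_choice[of "\<lambda>n P. stage U W P \<and> (n = 0 \<longrightarrow> P = (S, T))"
        "\<lambda>n P Q. fst P \<subseteq> fst Q \<and> snd P \<subseteq> snd Q \<and>
           (?e n \<in> formulas_over ?V \<longrightarrow> decides ?V (?e n) Q)"]
    by (metis (no_types, lifting) Zero_not_Suc)
  define S' where "S' = (\<Union>n. fst (f n))"
  define T' where "T' = (\<Union>n. snd (f n))"
  have sub: "fst (f n) \<subseteq> S'" "snd (f n) \<subseteq> T'" for n
    by (auto simp: S'_def T'_def)
  have cons': "finitely_consistent S' T'"
    unfolding S'_def T'_def using f_Suc stage
    by (intro finitely_consistent_UN_chain) (auto simp: stage_def mono_iff_le_Suc)
  have "fst (f n) \<union> snd (f n) \<subseteq> formulas_over ?V" for n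
    using stage[of n] unfolding stage_def formulas_over_def by blast
  then have over': "S' \<subseteq> formulas_over ?V" "T' \<subseteq> formulas_over ?V"
    by (auto simp: S'_def T'_def)
  \<comment> \<open>Stage \<open>Suc (to_nat \<chi>)\<close> decides \<open>\<chi>\<close>.\<close>
  have decided: "\<exists>n. decides ?V \<chi> (f n)" if "\<chi> \<in> formulas_over ?V" for \<chi>
    using f_Suc(3)[of "to_nat \<chi>"] that by auto
  have "saturated ?V S' T'"
  proof (rule maximal_imp_saturated[OF cons' over'])
    fix \<chi> :: "('p, 'v) fm"
    assume \<chi>: "\<chi> \<in> formulas_over ?V"
    then obtain n where n: "decides ?V \<chi> (f n)"
      using decided by blast
    show "\<chi> \<in> S'" if "finitely_consistent (insert \<chi> S') T'"
    proof -
      \<comment> \<open>Consistency with the limit implies consistency with stage \<open>n\<close>,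
        where \<open>\<chi>\<close> was tested.\<close>
      have "finitely_consistent (insert \<chi> (fst (f n))) (snd (f n))"
        by (rule finitely_consistent_mono[OF that]) (use sub[of n] in auto)
      then show ?thesis
        using n sub[of n] by (auto simp: decides_def)
    qed
    show "\<chi> \<in> T'" if "finitely_consistent S' (insert \<chi> T')"
    proof -
      have "finitely_consistent (fst (f n)) (insert \<chi> (snd (f n)))"
        by (rule finitely_consistent_mono[OF that]) (use sub[of n] in auto)
      then show ?thesis
        using n sub[of n] by (auto simp: decides_def)
    qed
  next
    fix x \<psi>
    assume *: "Forall x \<psi> \<in> T'"
    then obtain n where n: "decides ?V (Forall x \<psi>) (f n)"
      using decided over'(2) by blast
    \<comment> \<open>The universal formula may have entered at a stage other than \<open>n\<close>,
      for instance as a witness instance. Inserting it into stage \<open>n\<close> remains inside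
      the consistent limit, so the test succeeds and gives a witness.\<close>
    have "finitely_consistent (fst (f n)) (insert (Forall x \<psi>) (snd (f n)))"
      by (rule finitely_consistent_mono[OF cons']) (use sub[of n] * in auto)
    then show "\<exists>z\<in>?V. subst z x \<psi> \<in> T'"
      using n sub[of n] unfolding decides_def by blast
  qed
  moreover have "S \<subseteq> S'" "T \<subseteq> T'"
    using sub[of 0] f0 by auto
  ultimately show thesis
    using that by blast
qed

section \<open>Reserving variables and building the successor pair\<close>

text \<open>The even positions of an injective sequence in \<open>A\<close> form \<open>B\<close>;
  the odd ones remain outside it.\<close>

lemma infinite_split:
  assumes "infinite A"
  obtains B where "B \<subseteq> A" "infinite B" "infinite (A - B)"
proof -
  obtain f :: "nat \<Rightarrow> 'a" where f: "inj f" "range f \<subseteq> A"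
    using infinite_countable_subset[OF assms] by blast
  let ?B = "range (\<lambda>n. f (2 * n))"
  have "inj (\<lambda>n. f (2 * n))" "inj (\<lambda>n. f (2 * n + 1))"
    by (auto intro!: injI dest!: injD[OF f(1)])
  then have "infinite ?B" "infinite (range (\<lambda>n. f (2 * n + 1)))"
    by (auto dest: finite_imageD)
  moreover have "range (\<lambda>n. f (2 * n + 1)) \<subseteq> A - ?B"
  proof -
    have "f (2 * m + 1) \<noteq> f (2 * n)" for m n
    proof
      assume "f (2 * m + 1) = f (2 * n)"
      from injD[OF f(1) this] show False
        by presburger
    qed
    then show ?thesis
      using f(2) by auto
  qed
  ultimately have "infinite ?B" "infinite (A - ?B)"
    using infinite_super by metis+
  then show thesis
    by (intro that[of ?B]) (use f(2) in auto)
qed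

theorem theorem7:
  fixes U :: "'v :: countable set"
    and S T :: "('p :: countable, 'v) fm set"
    and \<phi> :: "('p, 'v) fm"
  assumes "coinfinite U"
    and "saturated U S T"
    and "GL_pair S T"
    and "Box \<phi> \<in> T"
  shows "\<exists>U' S' T'. coinfinite U' \<and> saturated U' S' T' \<and> GL_pair S' T' \<and>
           U \<subseteq> U' \<and> \<phi> \<in> T' \<and> Box -` S \<union> Box ` (Box -` S) \<subseteq> S'"
proof -
  obtain W where W: "W \<subseteq> - U" "infinite W" "infinite (- U - W)"
    using infinite_split[OF assms(1)] by blast
  have cons: "finitely_consistent S T" and over: "S \<subseteq> formulas_over U" "T \<subseteq> formulas_over U"
    using assms(2) by (auto simp: saturated_def)
  have "Box -` S \<union> Box ` (Box -` S) \<subseteq> formulas_over U" "{\<phi>} \<subseteq> formulas_over U"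
    using over assms(4) by (fastforce simp: formulas_over_def)+
  then obtain S' T' where sat: "saturated (U \<union> W) S' T'"
    and sub: "Box -` S \<union> Box ` (Box -` S) \<subseteq> S'" "{\<phi>} \<subseteq> T'"
    using saturated_extension[OF consistent_box[OF cons assms(4)], of U W] W(1,2) by blast
  have "GL_pair S' T'"
  proof -
    obtain n where "Box (Neg ((Dia ^^ n) Top)) \<in> S"
      using assms(3) by (auto simp: GL_pair_def)
    then have "Box (Neg ((Dia ^^ n) Top)) \<in> S'"
      using sub(1) by auto
    moreover have "finitely_consistent S' T'"
      using sat by (simp add: saturated_def)
    ultimately show ?thesis
      by (auto simp: GL_pair_def)
  qed
  moreover have "coinfinite (U \<union> W)"
    using W(3) by (simp add: Diff_eq)
  ultimately show ?thesis
    using sat sub by blast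
qed

end
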